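(* For all points $x,y\in\mathbb{B}^2$, $$w_{\mathbb{B}^2}(x,y)\leq p_{\mathbb{B}^2}(x,y)\leq\sqrt{2}\,w_{\mathbb{B}^2}(x,y),$$ where the equality $w_{\mathbb{B}^2}(x,y)=p_{\mathbb{B}^2}(x,y)$ holds whenever $x,y$ are on the same ray starting from the origin, and $p_{\mathbb{B}^2}(x,y)=\sqrt{2}\,w_{\mathbb{B}^2}(x,y)$ holds when $x=-y$ and $|x|=|y|=1/2$.
   Context: $\mathbb{B}^2=\{x\in\mathbb{R}^2 : |x|<1\}$ is the open unit disk. For $G=\mathbb{B}^2$ and $x\in G$, let $d_G(x)=\inf\{|x-z| : z\in\partial G\}=1-|x|$ and $$\widetilde{X}=\{\widetilde{x}\in\mathbb{R}^2 : |x-\widetilde{x}|=2d_G(x),\ (x+\widetilde{x})/2\in\partial G\};$$ for $y\in G$ the set $\widetilde{Y}$ is defined in the same way from $y$. The function $w_G:G\times G\to[0,1]$ is $$w_G(x,y)=\frac{|x-y|}{\min\{\inf_{\widetilde{y}\in\widetilde{Y}}|x-\widetilde{y}|,\ \inf_{\widetilde{x}\in\widetilde{X}}|y-\widetilde{x}|\}}.$$ The point pair function is $$p_G(x,y)=\frac{|x-y|}{\sqrt{|x-y|^2+4d_G(x)d_G(y)}}.$$ *)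

theory Defs
  imports "HOL-Analysis.Analysis"
begin

definition bdist :: "(real^2) set \<Rightarrow> real^2 \<Rightarrow> real" where
  "bdist G x = infdist x (frontier G)"

definition reflections :: "(real^2) set \<Rightarrow> real^2 \<Rightarrow> (real^2) set" where
  "reflections G x = {x'. dist x x' = 2 * bdist G x \<and> midpoint x x' \<in> frontier G}"

(* infdist is 0 on the empty set; for a proper nonempty open G the set of
   reflections of a point of G is never empty, so it is the true infimum. *)
definition w_fun :: "(real^2) set \<Rightarrow> real^2 \<Rightarrow> real^2 \<Rightarrow> real" where
  "w_fun G x y =
     dist x y / min (infdist x (reflections G y)) (infdist y (reflections G x))"

definition p_fun :: "(real^2) set \<Rightarrow> real^2 \<Rightarrow> real^2 \<Rightarrow> real" where
  "p_fun G x y = dist x y / sqrt ((dist x y)\<^sup>2 + 4 * bdist G x * bdist G y)"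

definition ray_from_origin :: "real^2 \<Rightarrow> (real^2) set" where
  "ray_from_origin u = {t *\<^sub>R u | t. t \<ge> 0}"

end

theory Submission
  imports Defs
begin

text \<open>Write x = r m and y = s n with unit vectors m, n and put u = 1 - m \<bullet> n. With
  q = (2 - r - s)^2, the squared denominator of p is q + 2rsu, while the two squared distances
  in the denominator of w are q + 2(2-r)su and q + 2(2-s)ru. Since r, s < 1, the latter are
  at least the former. For s \<le> r, the factor 2 reduces to 2su(2-3r) \<le> q, which at u = 2 is the
  inequality (2 - 4r)^2 + (r-s)(12 - 15r - s) \<ge> 0 for r \<le> 2/3.\<close>

text \<open>The reverse triangle inequality gives the lower bound, and the point of the sphere in
  the direction of \<open>x\<close> attains it; at \<open>x = 0\<close> any direction does.\<close>

lemma infdist_sphere_0: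
  fixes x :: "'a::euclidean_space"
  assumes "norm x \<le> R"
  shows "infdist x (sphere 0 R) = R - norm x"
proof -
  obtain e :: 'a where e: "norm e = 1" "x = norm x *\<^sub>R e"
  proof (cases "x = 0")
    case True
    then show ?thesis using that vector_choose_size[of 1, where 'a = 'a] by auto
  next
    case False
    then show ?thesis using that[of "sgn x"] by (simp add: norm_sgn sgn_div_norm)
  qed
  have R: "0 \<le> R" using assms norm_ge_zero order_trans by blast
  have *: "R *\<^sub>R e \<in> sphere 0 R" using e R by simp
  have "dist x (R *\<^sub>R e) = norm ((norm x - R) *\<^sub>R e)"
    using e(2) by (metis dist_norm scaleR_diff_left)
  also have "\<dots> = R - norm x" using e assms by simp
  finally have "infdist x (sphere 0 R) \<le> R - norm x"
    using infdist_le[OF *, of x] by simp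
  moreover have "R - norm x \<le> infdist x (sphere 0 R)"
  proof -
    have "R - norm x \<le> dist x z" if "z \<in> sphere 0 R" for z
      using that norm_triangle_ineq2[of z x] by (simp add: dist_norm norm_minus_commute)
    then show ?thesis
      using * R unfolding infdist_def by (auto intro!: cINF_greatest)
  qed
  ultimately show ?thesis by simp
qed

lemma bdist_unit_ball: "norm x \<le> 1 \<Longrightarrow> bdist (ball 0 1) x = 1 - norm x"
  by (simp add: bdist_def infdist_sphere_0)

lemma reflections_unit_ball_0: "reflections (ball 0 1) 0 = sphere 0 2"
  by (auto simp: reflections_def bdist_unit_ball midpoint_def)

text \<open>Off the centre the nearest boundary point is unique: a midpoint \<open>c\<close> on the
  circle at distance \<open>1 - r\<close> from \<open>r m\<close> must satisfy
  \<open>m \<bullet> c = 1\<close>, which forces \<open>c = m\<close> for unit vectors.\<close>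

lemma reflections_unit_ball:
  assumes m: "norm m = 1" and r: "0 < r" "r < 1"
  shows "reflections (ball 0 1) (r *\<^sub>R m) = {(2 - r) *\<^sub>R m}"
proof (intro set_eqI iffI)
  fix z
  assume "z \<in> reflections (ball 0 1) (r *\<^sub>R m)"
  then have d: "dist (r *\<^sub>R m) z = 2 * (1 - r)" and n: "norm (midpoint (r *\<^sub>R m) z) = 1"
    using m r by (auto simp: reflections_def bdist_unit_ball)
  define c where "c = midpoint (r *\<^sub>R m) z"
  have z: "z = 2 *\<^sub>R c - r *\<^sub>R m" unfolding c_def midpoint_def by simp
  have "norm (r *\<^sub>R m - c) = 1 - r"
  proof -
    have "r *\<^sub>R m - z = 2 *\<^sub>R (r *\<^sub>R m - c)"
      by (simp add: z algebra_simps flip: scaleR_2)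
    then show ?thesis using d by (simp add: dist_norm)
  qed
  then have "(norm (r *\<^sub>R m - c))\<^sup>2 = (1 - r)\<^sup>2" by simp
  moreover have mm: "m \<bullet> m = 1" "c \<bullet> c = 1"
    using m n by (simp_all add: c_def flip: power2_norm_eq_inner)
  ultimately have "r * (m \<bullet> c) = r"
    unfolding power2_norm_eq_inner
    by (simp add: inner_diff_left inner_diff_right inner_commute power2_eq_square algebra_simps)
  then have "m \<bullet> c = 1" using r by simp
  then have "(m - c) \<bullet> (m - c) = 0"
    using mm by (simp add: inner_diff_left inner_diff_right inner_commute)
  then have "c = m" by simp
  then show "z \<in> {(2 - r) *\<^sub>R m}" using z by (simp add: algebra_simps)
next
  fix z
  assume "z \<in> {(2 - r) *\<^sub>R m}"
  then have z: "z = (2 - r) *\<^sub>R m" by simp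
  have "midpoint (r *\<^sub>R m) z = m"
    by (simp add: z midpoint_def algebra_simps)
  moreover have "r *\<^sub>R m - z = (2 * r - 2) *\<^sub>R m"
    by (simp add: z algebra_simps flip: scaleR_2)
  ultimately show "z \<in> reflections (ball 0 1) (r *\<^sub>R m)"
    using m r by (simp add: reflections_def bdist_unit_ball dist_norm)
qed

text \<open>At r = 0 the centre has a whole circle of reflections; the nearest one to s n is 2 n,
  which is why the unit vectors are then required to agree.\<close>

lemma infdist_reflections_unit_ball:
  assumes m: "norm m = 1" and n: "norm n = 1"
    and r: "0 \<le> r" "r < 1" and s: "0 \<le> s" "s < 1"
    and eq: "r = 0 \<Longrightarrow> n = m"
  shows "infdist (s *\<^sub>R n) (reflections (ball 0 1) (r *\<^sub>R m))
    = sqrt ((2 - r - s)\<^sup>2 + 2 * (2 - r) * s * (1 - m \<bullet> n))"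
proof (cases "r = 0")
  case True
  then show ?thesis
    using eq n s by (simp add: reflections_unit_ball_0 infdist_sphere_0 flip: power2_norm_eq_inner)
next
  case False
  have mm: "m \<bullet> m = 1" "n \<bullet> n = 1" using m n by (simp_all flip: power2_norm_eq_inner)
  have "infdist (s *\<^sub>R n) (reflections (ball 0 1) (r *\<^sub>R m)) = norm (s *\<^sub>R n - (2 - r) *\<^sub>R m)"
    using False r m by (simp add: reflections_unit_ball dist_norm)
  also have "\<dots> = sqrt ((2 - r - s)\<^sup>2 + 2 * (2 - r) * s * (1 - m \<bullet> n))"
    by (simp add: norm_eq_sqrt_inner inner_diff_left inner_diff_right inner_commute mm
        power2_eq_square algebra_simps)
  finally show ?thesis .
qed

text \<open>A zero vector has no direction of its own, so it borrows that of the other vector. This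
  choice is what keeps the distance formula to the reflections valid at the centre.\<close>

lemma obtain_unit_directions:
  fixes x y :: "'a::euclidean_space"
  obtains m n where "norm m = 1" "norm n = 1" "x = norm x *\<^sub>R m" "y = norm y *\<^sub>R n"
    "x = 0 \<or> y = 0 \<Longrightarrow> n = m"
proof -
  obtain e :: 'a where "norm e = 1" using vector_choose_size[of 1] by auto
  then show ?thesis
    using that[of "sgn x" "sgn y"] that[of "sgn y" "sgn y"] that[of "sgn x" "sgn x"] that[of e e]
    by (cases "x = 0"; cases "y = 0") (auto simp: norm_sgn sgn_div_norm)
qed

text \<open>For \<open>s \<le> r\<close> the left side is the smaller of the two squared distances
  to reflections, so bounding this one is enough to bound their minimum.\<close>

lemma reflection_dist_upper:
  fixes r s u :: real
  assumes "0 \<le> s" "s \<le> r" "r < 1" "0 \<le> u" "u \<le> 2"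
  shows "(2 - r - s)\<^sup>2 + 2 * (2 - r) * s * u \<le> 2 * ((2 - r - s)\<^sup>2 + 2 * r * s * u)"
proof -
  have "2 * s * u * (2 - 3 * r) \<le> (2 - r - s)\<^sup>2"
  proof (cases "r \<le> 2/3")
    case True
    have "2 * s * u * (2 - 3 * r) \<le> 2 * s * 2 * (2 - 3 * r)"
      using assms True by (intro mult_right_mono mult_left_mono) auto
    also have "\<dots> \<le> (2 - r - s)\<^sup>2"
    proof -
      \<comment> \<open>This is right side minus left side, arranged around the diagonal
        \<open>s = r\<close>. The last factor is at least \<open>12 - 16 * r\<close>, which is
        positive here. The whole expression vanishes at \<open>r = s = 1/2\<close>, the equality
        case.\<close>
      have "0 \<le> (2 - 4 * r)\<^sup>2 + (r - s) * (12 - 15 * r - s)"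
        using assms True by (intro add_nonneg_nonneg mult_nonneg_nonneg) auto
      then show ?thesis by (simp add: power2_eq_square algebra_simps)
    qed
    finally show ?thesis .
  next
    case False
    then have "2 * s * u * (2 - 3 * r) \<le> 0"
      using assms by (intro mult_nonneg_nonpos mult_nonneg_nonneg) auto
    then show ?thesis using zero_le_power2[of "2 - r - s"] by linarith
  qed
  then show ?thesis by (simp add: algebra_simps)
qed

theorem theorem5p10:
  fixes x y :: "real^2"
  assumes "x \<in> ball 0 1" and "y \<in> ball 0 1"
  shows "w_fun (ball 0 1) x y \<le> p_fun (ball 0 1) x y
    \<and> p_fun (ball 0 1) x y \<le> sqrt 2 * w_fun (ball 0 1) x y
    \<and> ((\<exists>u. u \<noteq> 0 \<and> x \<in> ray_from_origin u \<and> y \<in> ray_from_origin u)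
         \<longrightarrow> w_fun (ball 0 1) x y = p_fun (ball 0 1) x y)
    \<and> (x = - y \<and> norm x = 1/2 \<and> norm y = 1/2
         \<longrightarrow> p_fun (ball 0 1) x y = sqrt 2 * w_fun (ball 0 1) x y)"
proof -
  define r s where "r = norm x" and "s = norm y"
  have r: "0 \<le> r" "r < 1" and s: "0 \<le> s" "s < 1"
    using assms by (auto simp: r_def s_def)
  obtain m n where m: "norm m = 1" and n: "norm n = 1"
    and x: "x = r *\<^sub>R m" and y: "y = s *\<^sub>R n" and z: "x = 0 \<or> y = 0 \<Longrightarrow> n = m"
    using obtain_unit_directions[of x y] unfolding r_def s_def by metis
  define u where "u = 1 - m \<bullet> n"
  have mm: "m \<bullet> m = 1" "n \<bullet> n = 1" using m n by (simp_all flip: power2_norm_eq_inner)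
  have u: "0 \<le> u" "u \<le> 2"
    using Cauchy_Schwarz_ineq2[of m n] m n by (auto simp: u_def)
  define A where "A = (2 - r - s)\<^sup>2 + 2 * (2 - r) * s * u"
  define B where "B = (2 - r - s)\<^sup>2 + 2 * (2 - s) * r * u"
  define P where "P = (2 - r - s)\<^sup>2 + 2 * r * s * u"
  have iA: "infdist y (reflections (ball 0 1) x) = sqrt A"
    unfolding x y A_def u_def using m n r s z x
    by (intro infdist_reflections_unit_ball) auto
  have iB: "infdist x (reflections (ball 0 1) y) = sqrt B"
  proof -
    have "infdist x (reflections (ball 0 1) y)
        = sqrt ((2 - s - r)\<^sup>2 + 2 * (2 - s) * r * (1 - n \<bullet> m))"
      unfolding x y using m n r s z y
      by (intro infdist_reflections_unit_ball) auto
    then show ?thesis by (simp add: B_def u_def inner_commute algebra_simps)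
  qed
  have w: "w_fun (ball 0 1) x y = dist x y / sqrt (min A B)"
    unfolding w_fun_def iA iB by (simp add: min_def)
  \<comment> \<open>The squared distance is \<open>(r - s)\<^sup>2 + 2 * r * s * u\<close>, and
    adding \<open>4 * (1 - r) * (1 - s)\<close> completes \<open>(r - s)\<^sup>2\<close> to
    \<open>(2 - r - s)\<^sup>2\<close>.\<close>
  have "(dist x y)\<^sup>2 + 4 * (1 - r) * (1 - s) = P"
    unfolding dist_norm power2_norm_eq_inner
    by (simp add: x y P_def u_def inner_diff_left inner_diff_right inner_commute mm
        power2_eq_square algebra_simps)
  then have p: "p_fun (ball 0 1) x y = dist x y / sqrt P"
    using r s by (simp add: p_fun_def bdist_unit_ball r_def s_def)
  have "0 < P"
    using r s u unfolding P_def by (intro add_pos_nonneg) auto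
  have "r * (s * u) \<le> (2 - r) * (s * u)" "s * (r * u) \<le> (2 - s) * (r * u)"
    using r s u by (intro mult_right_mono; simp)+
  then have lower: "P \<le> min A B"
    by (simp add: P_def A_def B_def algebra_simps)
  have upper: "min A B \<le> 2 * P"
  proof (cases "s \<le> r")
    case True
    then have "A \<le> 2 * P"
      unfolding A_def P_def using r s u by (intro reflection_dist_upper) auto
    then show ?thesis by simp
  next
    case False
    \<comment> \<open>The instance below exchanges the roles of \<open>r\<close> and
      \<open>s\<close>, which turns the left side of the lemma into \<open>B\<close>.\<close>
    then have "B \<le> 2 * P"
      using reflection_dist_upper[of r s u] r s u
      by (simp add: B_def P_def algebra_simps)
    then show ?thesis by simp
  qed
  have 1: "w_fun (ball 0 1) x y \<le> p_fun (ball 0 1) x y"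
    unfolding w p using \<open>0 < P\<close> lower by (intro divide_left_mono) auto
  \<comment> \<open>With the factor moved under the root, both sides have numerator
    \<open>dist x y\<close> and only the denominators are compared.\<close>
  have sqrt2: "sqrt 2 * (d / sqrt M) = d / sqrt (M / 2)" for d M
    by (simp add: real_sqrt_divide)
  have 2: "p_fun (ball 0 1) x y \<le> sqrt 2 * w_fun (ball 0 1) x y"
    unfolding w p sqrt2 using \<open>0 < P\<close> lower upper by (intro divide_left_mono) auto
  have 3: "w_fun (ball 0 1) x y = p_fun (ball 0 1) x y"
    if "\<exists>v. v \<noteq> 0 \<and> x \<in> ray_from_origin v \<and> y \<in> ray_from_origin v"
  proof -
    from that obtain v a b where ab: "x = a *\<^sub>R v" "y = b *\<^sub>R v" "0 \<le> a" "0 \<le> b"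
      by (auto simp: ray_from_origin_def)
    then have "x \<bullet> y = r * s"
      by (simp add: r_def s_def flip: power2_norm_eq_inner) (simp add: power2_eq_square)
    then have "r * s * u = 0"
      by (simp add: x y u_def algebra_simps)
    \<comment> \<open>If one point is the centre, the product says nothing about \<open>u\<close>;
      the choice \<open>n = m\<close> settles that case.\<close>
    moreover have "u = 0" if "r = 0 \<or> s = 0"
      using that z mm x y by (auto simp: u_def)
    ultimately have "u = 0" by auto
    then show ?thesis by (simp add: w p A_def B_def P_def)
  qed
  have 4: "p_fun (ball 0 1) x y = sqrt 2 * w_fun (ball 0 1) x y"
    if "x = - y" "norm x = 1/2" "norm y = 1/2"
  proof -
    have rs: "r = 1/2" "s = 1/2" using that by (auto simp: r_def s_def)
    \<comment> \<open>Antipodal points have opposite directions, so \<open>u\<close> takes its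
      largest value 2, where \<open>A = B = 2 * P\<close>.\<close>
    have "(1/2::real) *\<^sub>R m = (1/2) *\<^sub>R (- n)"
      using that(1) x y unfolding rs by simp
    then have "m = - n" unfolding scaleR_cancel_left by simp
    then have "u = 2" using mm by (simp add: u_def)
    then have "A = 4" "B = 4" "P = 2"
      unfolding A_def B_def P_def rs by simp_all
    then show ?thesis unfolding w p sqrt2 by simp
  qed
  from 1 2 3 4 show ?thesis by blast
qed

end
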